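(* Let $G$ be a locally compact $IN$-group, let $K=K_G$ be the intersection of all closed invariant neighborhoods of the identity $e$ of $G$ (a compact normal subgroup of $G$), and let $\theta: G\to G/K$ be the natural homomorphism. Then $$UCS(G)=\{h\circ\theta : h\in UCS(G/K)\}.$$
   Context: A subset of a group $G$ is invariant if it is invariant under all inner automorphisms of $G$. A locally compact group $G$ is an $IN$-group if it has a compact invariant neighborhood of the identity $e$. It is known that for an $IN$-group $G$ the intersection $K_G$ of all closed invariant neighborhoods of $e$ is a compact normal subgroup of $G$. For a locally compact group $G$, $C(G)$ denotes the bounded continuous complex-valued functions on $G$; for $f\in C(G)$ and $x,y\in G$ put ${}_xf_y(z)=f(xzy)$, and let $O(f)=\{{}_xf_y: x,y\in G\}$ be the double orbit. $UCS(G)=\{f\in C(G): O(f)\text{ is equicontinuous on } G\}$. *)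

theory Defs
  imports "HOL-Analysis.Analysis" "HOL-Algebra.Coset"
begin

locale topological_group = group G for G (structure) +
  fixes T :: "'a topology"
  assumes topspace_eq_carrier: "topspace T = carrier G"
    and continuous_mult: "continuous_map (prod_topology T T) T (\<lambda>(x, y). x \<otimes> y)"
    and continuous_inv: "continuous_map T T (\<lambda>x. inv x)"

text \<open>As usual for locally compact groups, the topology is required to be Hausdorff.\<close>

locale locally_compact_group = topological_group +
  assumes Hausdorff: "Hausdorff_space T"
    and locally_compact: "locally_compact_space T"

definition neighborhood_of :: "'a topology \<Rightarrow> 'a \<Rightarrow> 'a set \<Rightarrow> bool" where
  "neighborhood_of T x V \<longleftrightarrow> V \<subseteq> topspace T \<and> (\<exists>U. openin T U \<and> x \<in> U \<and> U \<subseteq> V)"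

definition invariant :: "('a, 'b) monoid_scheme \<Rightarrow> 'a set \<Rightarrow> bool" where
  "invariant G V \<longleftrightarrow> V \<subseteq> carrier G \<and>
     (\<forall>g \<in> carrier G. (\<lambda>v. g \<otimes>\<^bsub>G\<^esub> v \<otimes>\<^bsub>G\<^esub> inv\<^bsub>G\<^esub> g) ` V = V)"

locale IN_group = locally_compact_group +
  assumes compact_invariant_neighborhood:
    "\<exists>V. compactin T V \<and> invariant G V \<and> neighborhood_of T \<one> V"

definition IN_kernel :: "('a, 'b) monoid_scheme \<Rightarrow> 'a topology \<Rightarrow> 'a set" where
  "IN_kernel G T = \<Inter>{V. closedin T V \<and> invariant G V \<and> neighborhood_of T \<one>\<^bsub>G\<^esub> V}"

text \<open>Functions on \<open>G\<close> are represented as extensional functions on the carrier, so that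
  equality of HOL functions is equality on \<open>G\<close>.\<close>

definition bounded_continuous :: "('a, 'b) monoid_scheme \<Rightarrow> 'a topology \<Rightarrow> ('a \<Rightarrow> complex) set" where
  "bounded_continuous G T =
     {f \<in> extensional (carrier G). continuous_map T euclidean f \<and> bounded (f ` carrier G)}"

definition double_orbit :: "('a, 'b) monoid_scheme \<Rightarrow> ('a \<Rightarrow> complex) \<Rightarrow> ('a \<Rightarrow> complex) set" where
  "double_orbit G f =
     {\<lambda>z\<in>carrier G. f (x \<otimes>\<^bsub>G\<^esub> z \<otimes>\<^bsub>G\<^esub> y) | x y. x \<in> carrier G \<and> y \<in> carrier G}"

definition equicontinuous :: "'a topology \<Rightarrow> ('a \<Rightarrow> 'm::metric_space) set \<Rightarrow> bool" where
  "equicontinuous T F \<longleftrightarrow>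
     (\<forall>z \<in> topspace T. \<forall>\<epsilon>>0. \<exists>U. openin T U \<and> z \<in> U \<and> (\<forall>g \<in> F. \<forall>w \<in> U. dist (g w) (g z) < \<epsilon>))"

definition UCS :: "('a, 'b) monoid_scheme \<Rightarrow> 'a topology \<Rightarrow> ('a \<Rightarrow> complex) set" where
  "UCS G T = {f \<in> bounded_continuous G T. equicontinuous T (double_orbit G f)}"

definition quotient_hom :: "('a, 'b) monoid_scheme \<Rightarrow> 'a set \<Rightarrow> 'a \<Rightarrow> 'a set" where
  "quotient_hom G K x = K #>\<^bsub>G\<^esub> x"

definition quotient_topology :: "('a, 'b) monoid_scheme \<Rightarrow> 'a topology \<Rightarrow> 'a set \<Rightarrow> 'a set topology" where
  "quotient_topology G T K =
     topology (\<lambda>U. U \<subseteq> carrier (G Mod K) \<and> openin T {x \<in> carrier G. quotient_hom G K x \<in> U})"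

lemma openin_quotient_topology:
  assumes "topspace T = carrier G"
  shows "openin (quotient_topology G T K) U \<longleftrightarrow>
     U \<subseteq> carrier (G Mod K) \<and> openin T {x \<in> carrier G. quotient_hom G K x \<in> U}"
proof -
  let ?P = "\<lambda>U. {x \<in> carrier G. quotient_hom G K x \<in> U}"
  have Int: "?P (A \<inter> B) = ?P A \<inter> ?P B" for A B
    by auto
  have Un: "?P (\<Union>\<U>) = \<Union>(?P ` \<U>)" for \<U>
    by auto
  have "istopology (\<lambda>U. U \<subseteq> carrier (G Mod K) \<and> openin T (?P U))"
    unfolding istopology_def Int Un by (blast intro: openin_Int openin_Union)
  then show ?thesis
    by (simp add: quotient_topology_def topology_inverse')
qed

lemma topspace_quotient_topology:
  assumes "topspace T = carrier G"
  shows "topspace (quotient_topology G T K) = carrier (G Mod K)"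
proof -
  have "{x \<in> carrier G. quotient_hom G K x \<in> carrier (G Mod K)} = topspace T"
    using assms by (auto simp: carrier_FactGroup quotient_hom_def)
  then have "openin (quotient_topology G T K) (carrier (G Mod K))"
    by (simp add: openin_quotient_topology [OF assms])
  then show ?thesis
    by (metis assms openin_quotient_topology openin_subset openin_topspace subset_antisym)
qed

lemma quotient_map_quotient_hom:
  assumes "topspace T = carrier G"
  shows "quotient_map T (quotient_topology G T K) (quotient_hom G K)"
  unfolding quotient_map_def
  by (auto simp: assms openin_quotient_topology topspace_quotient_topology
      carrier_FactGroup quotient_hom_def)

end

theory Submission
  imports Defs
begin

text \<open>
  Write \<open>K\<close> for the intersection of the closed invariant neighborhoods of \<open>\<one>\<close>.

  A function in \<open>UCS\<close> cannot see \<open>K\<close>.  Given \<open>\<epsilon> > 0\<close>, let \<open>V\<close> be the set of all \<open>v\<close> such that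
  inserting \<open>v\<close> between any two factors \<open>x\<close> and \<open>y\<close> changes \<open>f (x \<otimes> y)\<close> by at most \<open>\<epsilon>\<close>.  This set is
  closed because \<open>f\<close> is continuous, invariant because a conjugation can be absorbed into \<open>x\<close> and \<open>y\<close>,
  and a neighborhood of \<open>\<one>\<close> because the double orbit is equicontinuous there; so it contains \<open>K\<close>.
  As \<open>\<epsilon>\<close> is arbitrary, \<open>f\<close> is constant on the cosets of \<open>K\<close> and factors through the quotient map,
  which is continuous and open and therefore carries equicontinuity of double orbits both ways.

  This presupposes that \<open>K\<close> is a normal subgroup.  Closure under products is the substantial point:
  two conjugates \<open>g \<otimes> u \<otimes> inv g\<close> and \<open>h \<otimes> v \<otimes> inv h\<close> with \<open>u\<close> and \<open>v\<close> close to \<open>\<one>\<close> have no evident common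
  conjugator, so their product is not visibly a conjugate of something close to \<open>\<one>\<close>.  It suffices
  (\<open>IN_kernel_mult_interior\<close>) that left translation by any \<open>x \<in> K\<close> maps the interior of every
  compact invariant set \<open>W\<close> into \<open>W\<close>.  One could derive this from the Haar measure:
  conjugation preserves it, so the measure of \<open>W \<inter> vW\<close> is a class function of \<open>v\<close> that is
  continuous at \<open>\<one>\<close>, hence equals the measure of \<open>W\<close> for \<open>v \<in> K\<close>.  The proof below replaces the measure
  by a finite count.  If \<open>x\<close> moved a compact set \<open>B \<subseteq> W\<close> with nonempty interior off \<open>W\<close>, then, because \<open>x\<close>
  is a limit of conjugates of elements \<open>u\<close> close to \<open>\<one>\<close>, such elements \<open>u\<close> would move conjugates of \<open>B\<close> off \<open>W\<close>.
  As \<open>u\<close> tends to \<open>\<one>\<close> the images come closer and closer to \<open>W\<close>, so infinitely many of them can be chosen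
  disjoint, all inside one compact invariant set \<open>C\<close>.  But finitely many translates of \<open>B\<close> cover
  \<open>C\<close>, and by invariance of \<open>C\<close> equally many translates of any conjugate of \<open>B\<close> do.  Each of
  the disjoint images thus takes up at least a fixed fraction of \<open>C\<close>, which bounds their number
  (\<open>card_disjoint_compact_le_card_cover\<close>).
\<close>

section \<open>Topological groups\<close>

context topological_group
begin

lemma mult_inv_cancel_left:
  assumes "a \<in> carrier G" "b \<in> carrier G"
  shows "inv a \<otimes> (a \<otimes> b) = b" "a \<otimes> (inv a \<otimes> b) = b"
  using assms by (simp_all flip: m_assoc)

lemma continuous_map_group_mult:
  assumes "continuous_map X T f" "continuous_map X T g"
  shows "continuous_map X T (\<lambda>x. f x \<otimes> g x)"
proof -
  have "continuous_map X (prod_topology T T) (\<lambda>x. (f x, g x))"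
    using assms by (simp add: continuous_map_pairedI)
  from continuous_map_compose [OF this continuous_mult] show ?thesis
    by (simp add: o_def)
qed

lemma continuous_map_group_inv:
  assumes "continuous_map X T f"
  shows "continuous_map X T (\<lambda>x. inv f x)"
  using continuous_map_compose [OF assms continuous_inv] by (simp add: o_def)

lemma continuous_map_group_const:
  "a \<in> carrier G \<Longrightarrow> continuous_map X T (\<lambda>x. a)"
  by (simp add: topspace_eq_carrier)

lemmas continuous_map_group_intros =
  continuous_map_group_mult continuous_map_group_inv continuous_map_group_const
  continuous_map_id [unfolded id_def]

lemma subset_carrier_compactin: "compactin T A \<Longrightarrow> A \<subseteq> carrier G"
  using compactin_subset_topspace topspace_eq_carrier by metis

lemma subset_carrier_openin: "openin T A \<Longrightarrow> A \<subseteq> carrier G"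
  using openin_subset topspace_eq_carrier by metis

lemma openin_mult_neighborhoods:
  assumes V: "openin T V" "x \<otimes> y \<in> V" and xy: "x \<in> carrier G" "y \<in> carrier G"
  obtains P Q where "openin T P" "openin T Q" "x \<in> P" "y \<in> Q"
    "\<And>p q. \<lbrakk>p \<in> P; q \<in> Q\<rbrakk> \<Longrightarrow> p \<otimes> q \<in> V"
proof -
  define A where "A = {p \<in> topspace (prod_topology T T). (\<lambda>(x, y). x \<otimes> y) p \<in> V}"
  have "openin (prod_topology T T) A"
    unfolding A_def by (rule openin_continuous_map_preimage [OF continuous_mult V(1)])
  moreover have "(x, y) \<in> A"
    using V xy by (simp add: A_def topspace_eq_carrier)
  ultimately obtain P Q where PQ: "openin T P" "openin T Q" "x \<in> P" "y \<in> Q" "P \<times> Q \<subseteq> A"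
    unfolding openin_prod_topology_alt by meson
  have "p \<otimes> q \<in> V" if "p \<in> P" "q \<in> Q" for p q
    using PQ(5) that by (auto simp: A_def)
  with PQ show ?thesis
    using that by blast
qed

lemma compactin_set_mult:
  assumes "compactin T A" "compactin T B"
  shows "compactin T (A <#> B)"
proof -
  have "compactin (prod_topology T T) (A \<times> B)"
    using assms by (simp add: compactin_Times)
  from image_compactin [OF this continuous_mult] show ?thesis
    by (rule back_subst) (auto simp: set_mult_def image_def)
qed

lemma compactin_set_inv:
  assumes "compactin T A"
  shows "compactin T (set_inv A)"
  using image_compactin [OF assms continuous_inv]
  by (rule back_subst) (auto simp: SET_INV_def)

lemma compactin_l_coset:
  assumes "compactin T A" "u \<in> carrier G"
  shows "compactin T (u <# A)"
  using compactin_set_mult [of "{u}" A] assms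
  by (simp add: l_coset_eq_set_mult topspace_eq_carrier)

lemma openin_l_coset:
  assumes "openin T A" "u \<in> carrier G"
  shows "openin T (u <# A)"
proof -
  have "openin T {x \<in> topspace T. inv u \<otimes> x \<in> A}"
    by (rule openin_continuous_map_preimage [OF _ assms(1)])
      (intro continuous_map_group_intros, use assms in auto)
  also have "{x \<in> topspace T. inv u \<otimes> x \<in> A} = u <# A"
    using assms subset_carrier_openin [OF assms(1)]
    by (force simp: l_coset_def topspace_eq_carrier image_iff mult_inv_cancel_left)
  finally show ?thesis .
qed

lemma compactin_covered_by_l_cosets:
  assumes C: "compactin T C" and U: "openin T U" "w \<in> U"
  obtains F where "finite F" "F \<subseteq> carrier G" "C \<subseteq> F <#> U"
proof -
  have Cc: "C \<subseteq> carrier G" and w: "w \<in> carrier G"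
    using C U subset_carrier_compactin subset_carrier_openin by blast+
  have "C \<subseteq> \<Union>((\<lambda>t. t <# U) ` carrier G)"
  proof
    fix c assume "c \<in> C"
    with Cc w have "c \<otimes> inv w \<in> carrier G" "c = (c \<otimes> inv w) \<otimes> w"
      by (auto simp: m_assoc)
    then show "c \<in> \<Union>((\<lambda>t. t <# U) ` carrier G)"
      using U by (auto simp: l_coset_def)
  qed
  moreover have "\<forall>V\<in>(\<lambda>t. t <# U) ` carrier G. openin T V"
    using openin_l_coset U by blast
  ultimately obtain \<F> where \<F>: "finite \<F>" "\<F> \<subseteq> (\<lambda>t. t <# U) ` carrier G" "C \<subseteq> \<Union>\<F>"
    using C unfolding compactin_def by meson
  then obtain F where "F \<subseteq> carrier G" "finite F" "\<F> = (\<lambda>t. t <# U) ` F"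
    by (meson finite_subset_image)
  then show ?thesis
    using \<F> that [of F] by (auto simp: l_coset_def set_mult_def)
qed

lemma homeomorphic_map_conjugation:
  assumes "g \<in> carrier G"
  shows "homeomorphic_map T T (\<lambda>v. g \<otimes> v \<otimes> inv g)"
proof (rule homeomorphic_maps_imp_map)
  show "homeomorphic_maps T T (\<lambda>v. g \<otimes> v \<otimes> inv g) (\<lambda>v. inv g \<otimes> v \<otimes> g)"
    unfolding homeomorphic_maps_def
  proof (intro conjI ballI)
    show "continuous_map T T (\<lambda>v. g \<otimes> v \<otimes> inv g)" "continuous_map T T (\<lambda>v. inv g \<otimes> v \<otimes> g)"
      by (intro continuous_map_group_intros; use assms in simp)+
  qed (use assms in \<open>simp_all add: topspace_eq_carrier m_assoc mult_inv_cancel_left\<close>)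
qed

text \<open>Equality of each conjugate with \<open>V\<close> follows from inclusion, applied to the conjugations by \<open>g\<close> and by its
  inverse.\<close>

lemma invariantI:
  assumes "V \<subseteq> carrier G"
    and "\<And>g v. g \<in> carrier G \<Longrightarrow> v \<in> V \<Longrightarrow> g \<otimes> v \<otimes> inv g \<in> V"
  shows "invariant G V"
  unfolding invariant_def
proof (intro conjI ballI equalityI subsetI)
  fix g v assume g: "g \<in> carrier G" and v: "v \<in> V"
  have "v = g \<otimes> (inv g \<otimes> v \<otimes> inv (inv g)) \<otimes> inv g"
    using g v assms(1) by (simp add: m_assoc subset_eq mult_inv_cancel_left)
  moreover have "inv g \<otimes> v \<otimes> inv (inv g) \<in> V"
    using g v assms(2) inv_closed by blast
  ultimately show "v \<in> (\<lambda>v. g \<otimes> v \<otimes> inv g) ` V"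
    by blast
qed (use assms in auto)

lemma invariantD:
  "\<lbrakk>invariant G V; g \<in> carrier G; v \<in> V\<rbrakk> \<Longrightarrow> g \<otimes> v \<otimes> inv g \<in> V"
  unfolding invariant_def by blast

lemma invariant_interior_of:
  assumes "invariant G V"
  shows "invariant G (T interior_of V)"
  unfolding invariant_def
proof (intro conjI ballI)
  show "T interior_of V \<subseteq> carrier G"
    by (simp add: interior_of_subset_topspace flip: topspace_eq_carrier)
  fix g assume g: "g \<in> carrier G"
  show "(\<lambda>v. g \<otimes> v \<otimes> inv g) ` (T interior_of V) = T interior_of V"
    using homeomorphic_map_interior_of [OF homeomorphic_map_conjugation [OF g], of V] assms g
    by (simp add: invariant_def topspace_eq_carrier)
qed

lemma invariant_closure_of:
  assumes "invariant G V"
  shows "invariant G (T closure_of V)"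
  unfolding invariant_def
proof (intro conjI ballI)
  show "T closure_of V \<subseteq> carrier G"
    by (simp add: closure_of_subset_topspace flip: topspace_eq_carrier)
  fix g assume g: "g \<in> carrier G"
  show "(\<lambda>v. g \<otimes> v \<otimes> inv g) ` (T closure_of V) = T closure_of V"
    using homeomorphic_map_closure_of [OF homeomorphic_map_conjugation [OF g], of V] assms g
    by (simp add: invariant_def topspace_eq_carrier)
qed

lemma invariant_set_mult:
  assumes "invariant G A" "invariant G B"
  shows "invariant G (A <#> B)"
proof (rule invariantI)
  have AB: "A \<subseteq> carrier G" "B \<subseteq> carrier G"
    using assms by (auto simp: invariant_def)
  then show "A <#> B \<subseteq> carrier G"
    by (rule set_mult_closed)
  fix g v assume g: "g \<in> carrier G" and "v \<in> A <#> B"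
  then obtain a b where ab: "a \<in> A" "b \<in> B" "v = a \<otimes> b"
    by (auto simp: set_mult_def)
  have "g \<otimes> v \<otimes> inv g = (g \<otimes> a \<otimes> inv g) \<otimes> (g \<otimes> b \<otimes> inv g)"
    using ab g AB by (simp add: m_assoc subset_eq mult_inv_cancel_left)
  then show "g \<otimes> v \<otimes> inv g \<in> A <#> B"
    using ab g assms unfolding set_mult_def by (blast intro: invariantD)
qed

lemma neighborhood_of_iff_interior:
  assumes "V \<subseteq> carrier G"
  shows "neighborhood_of T x V \<longleftrightarrow> x \<in> T interior_of V"
  using assms by (auto simp: neighborhood_of_def interior_of_def topspace_eq_carrier)

text \<open>The closure of the union of all conjugates of \<open>U\<close> is itself a closed invariant neighborhood of
  \<open>\<one>\<close>, so it contains \<open>K\<close>.  Thus the elements of \<open>K\<close> are limits of conjugates of elements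
  arbitrarily close to \<open>\<one>\<close>.\<close>

lemma orbit_meets_IN_kernel_neighborhood:
  assumes x: "x \<in> IN_kernel G T"
    and U: "openin T U" "\<one> \<in> U"
    and P: "openin T P" "x \<in> P"
  obtains u g where "u \<in> U" "g \<in> carrier G" "g \<otimes> u \<otimes> inv g \<in> P"
proof -
  let ?O = "\<Union>g\<in>carrier G. (\<lambda>v. g \<otimes> v \<otimes> inv g) ` U"
  have Uc: "U \<subseteq> carrier G"
    using U subset_carrier_openin by blast
  have UO: "U \<subseteq> ?O"
  proof
    fix v assume "v \<in> U"
    then have "v = \<one> \<otimes> v \<otimes> inv \<one>"
      using Uc by auto
    with \<open>v \<in> U\<close> show "v \<in> ?O"
      by blast
  qed
  have Oc: "?O \<subseteq> carrier G"
    using Uc by auto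
  have "invariant G ?O"
  proof (rule invariantI [OF Oc])
    fix g v assume g: "g \<in> carrier G" and "v \<in> ?O"
    then obtain h u where hu: "h \<in> carrier G" "u \<in> U" "v = h \<otimes> u \<otimes> inv h"
      by auto
    then have "g \<otimes> v \<otimes> inv g = (g \<otimes> h) \<otimes> u \<otimes> inv (g \<otimes> h)"
      using g Uc by (simp add: m_assoc subset_eq inv_mult_group)
    then show "g \<otimes> v \<otimes> inv g \<in> ?O"
      using g hu by blast
  qed
  then have "invariant G (T closure_of ?O)"
    by (rule invariant_closure_of)
  moreover have "?O \<subseteq> T closure_of ?O"
    using Oc by (simp add: closure_of_subset topspace_eq_carrier)
  then have "neighborhood_of T \<one> (T closure_of ?O)"
    using U UO unfolding neighborhood_of_def by (meson closure_of_subset_topspace subset_trans)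
  ultimately have "x \<in> T closure_of ?O"
    using x by (simp add: IN_kernel_def)
  then obtain w where "w \<in> ?O" "w \<in> P"
    using P unfolding in_closure_of by blast
  then show ?thesis
    using that by auto
qed

end

section \<open>Packing disjoint compact sets\<close>

text \<open>A finite substitute for the measure of a set: the number of left translates of a small open set \<open>U\<close>
  that are needed to cover it.  If \<open>M\<close> left translates of \<open>S\<close> cover \<open>C\<close>, this number for \<open>S\<close> is at least
  the number for \<open>C\<close> divided by \<open>M\<close>.  Once \<open>U\<close> is so small that none of its translates meets two members
  of \<open>\<S>\<close>, the numbers for the members add up to at most the number for \<open>C\<close>.  Different
  members may have entirely different shapes; only the bound \<open>M\<close> is common to them.\<close>

lemma (in locally_compact_group) card_disjoint_compact_le_card_cover:
  assumes fin: "finite \<S>" and disj: "pairwise disjnt \<S>"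
    and comp: "\<And>S. S \<in> \<S> \<Longrightarrow> compactin T S"
    and C: "compactin T C" "C \<noteq> {}" and sub: "\<And>S. S \<in> \<S> \<Longrightarrow> S \<subseteq> C"
    and cover: "\<And>S. S \<in> \<S> \<Longrightarrow> \<exists>F. finite F \<and> F \<subseteq> carrier G \<and> card F \<le> M \<and> C \<subseteq> F <#> S"
  shows "card \<S> \<le> M"
proof -
  \<comment> \<open>A left translate of \<open>U\<close> can meet two members only if some quotient of two elements of \<open>U\<close> lies in
    this compact set, which misses \<open>\<one>\<close> by disjointness.\<close>
  let ?D = "\<Union>S\<in>\<S>. \<Union>S'\<in>\<S> - {S}. set_inv S <#> S'"
  have "compactin T ?D"
    using fin comp
    by (intro compactin_Union) (auto intro!: compactin_Union compactin_set_mult compactin_set_inv)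
  then have "closedin T ?D"
    using Hausdorff compactin_imp_closedin by blast
  then have opD: "openin T (carrier G - ?D)"
    by (simp add: closedin_def topspace_eq_carrier)
  have "\<one> \<notin> ?D"
  proof
    assume "\<one> \<in> ?D"
    then obtain S S' s s' where *: "S \<in> \<S>" "S' \<in> \<S>" "S \<noteq> S'" "s \<in> S" "s' \<in> S'" "\<one> = inv s \<otimes> s'"
      by (auto simp: set_mult_def SET_INV_def)
    moreover from this have "s \<in> carrier G" "s' \<in> carrier G"
      using comp subset_carrier_compactin by blast+
    ultimately have "s = s'"
      by (metis mult_inv_cancel_left(2) r_one)
    with * disj show False
      by (auto simp: pairwise_def disjnt_def)
  qed
  obtain U1 U2 where U12: "openin T U1" "openin T U2" "\<one> \<in> U1" "\<one> \<in> U2"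
    and U12_sep: "\<And>u u'. \<lbrakk>u \<in> U1; u' \<in> U2\<rbrakk> \<Longrightarrow> u \<otimes> u' \<in> carrier G - ?D"
    by (rule openin_mult_neighborhoods [OF opD, of \<one> \<one>]) (use \<open>\<one> \<notin> ?D\<close> in simp_all)
  define U where "U = {u \<in> topspace T. inv u \<in> U1} \<inter> U2"
  have "openin T {u \<in> topspace T. inv u \<in> U1}"
    by (rule openin_continuous_map_preimage [OF continuous_inv U12(1)])
  then have U: "openin T U" "\<one> \<in> U"
    using U12 by (simp_all add: U_def openin_Int topspace_eq_carrier)
  have Uc: "U \<subseteq> carrier G"
    using U subset_carrier_openin by blast
  have U_sep: "inv u \<otimes> u' \<notin> ?D" if "u \<in> U" "u' \<in> U" for u u'
  proof -
    have "inv u \<in> U1" "u' \<in> U2"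
      using that unfolding U_def by blast+
    then show ?thesis
      using U12_sep by blast
  qed
  have Cc: "C \<subseteq> carrier G"
    using C subset_carrier_compactin by blast
  define cov where "cov F \<longleftrightarrow> finite F \<and> F \<subseteq> carrier G \<and> C \<subseteq> F <#> U" for F
  obtain F0 where "finite F0" "F0 \<subseteq> carrier G" "C \<subseteq> F0 <#> U"
    by (rule compactin_covered_by_l_cosets [OF C(1) U])
  then have F0: "cov F0"
    by (simp add: cov_def)
  obtain F where F: "cov F" and Fmin: "\<And>F'. cov F' \<Longrightarrow> card F \<le> card F'"
    using ex_has_least_nat [of cov F0 card, OF F0] by metis
  have Ff: "finite F" and Fc: "F \<subseteq> carrier G" and FC: "C \<subseteq> F <#> U"
    using F by (auto simp: cov_def)
  define part where "part S = {t \<in> F. (t <# U) \<inter> S \<noteq> {}}" for S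
  have part_disj: "part S \<inter> part S' = {}" if SS: "S \<in> \<S>" "S' \<in> \<S>" "S \<noteq> S'" for S S'
  proof (rule ccontr)
    assume "part S \<inter> part S' \<noteq> {}"
    then obtain t u u' where t: "t \<in> F" "u \<in> U" "t \<otimes> u \<in> S" "u' \<in> U" "t \<otimes> u' \<in> S'"
      by (auto simp: part_def l_coset_def)
    have "inv u \<otimes> u' = inv (t \<otimes> u) \<otimes> (t \<otimes> u')"
      using t Fc Uc by (simp add: subset_eq inv_mult_group m_assoc mult_inv_cancel_left)
    then have "inv u \<otimes> u' \<in> ?D"
      using t SS by (auto simp: set_mult_def SET_INV_def)
    with U_sep t show False by blast
  qed
  \<comment> \<open>Substituting a cover of \<open>S\<close> by translates of \<open>U\<close> into a cover of \<open>C\<close> by translates of \<open>S\<close> gives a cover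
    of \<open>C\<close>, to which the minimality of \<open>F\<close> applies.\<close>
  have part_ge: "card F \<le> M * card (part S)" if S: "S \<in> \<S>" for S
  proof -
    obtain E where E: "finite E" "E \<subseteq> carrier G" "card E \<le> M" "C \<subseteq> E <#> S"
      using cover [OF S] by blast
    have Sp: "S \<subseteq> part S <#> U"
    proof
      fix s assume "s \<in> S"
      then have "s \<in> F <#> U" using sub S FC by blast
      then show "s \<in> part S <#> U"
        using \<open>s \<in> S\<close> by (auto simp: part_def set_mult_def l_coset_def)
    qed
    have pf: "finite (part S)" "part S \<subseteq> carrier G"
      using Ff Fc by (auto simp: part_def)
    have "C \<subseteq> E <#> (part S <#> U)"
      using E(4) Sp by (force simp: set_mult_def)
    then have "C \<subseteq> (E <#> part S) <#> U"
      using set_mult_assoc E pf Uc by simp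
    moreover have "finite (E <#> part S)" "E <#> part S \<subseteq> carrier G"
      using E pf by (auto simp: set_mult_def)
    ultimately have "cov (E <#> part S)"
      unfolding cov_def by blast
    then have "card F \<le> card (E <#> part S)"
      by (rule Fmin)
    also have "E <#> part S = (\<lambda>(a, b). a \<otimes> b) ` (E \<times> part S)"
      by (auto simp: set_mult_def)
    also have "card \<dots> \<le> card (E \<times> part S)"
      using E pf by (intro card_image_le) auto
    also have "\<dots> = card E * card (part S)"
      by (simp add: card_cartesian_product)
    also have "\<dots> \<le> M * card (part S)"
      using E by simp
    finally show ?thesis .
  qed
  have "card \<S> * card F = (\<Sum>S\<in>\<S>. card F)"
    by simp
  also have "\<dots> \<le> (\<Sum>S\<in>\<S>. M * card (part S))"
    by (intro sum_mono part_ge)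
  also have "\<dots> = M * (\<Sum>S\<in>\<S>. card (part S))"
    by (simp add: sum_distrib_left)
  also have "(\<Sum>S\<in>\<S>. card (part S)) = card (\<Union>S\<in>\<S>. part S)"
    using fin Ff part_disj by (subst card_UN_disjoint) (auto simp: part_def)
  also have "\<dots> \<le> card F"
    using Ff by (intro card_mono) (auto simp: part_def)
  finally have "card \<S> * card F \<le> M * card F"
    by simp
  moreover have "card F > 0"
    using Ff FC C(2) by (auto simp: card_gt_0_iff set_mult_def)
  ultimately show ?thesis
    by simp
qed

section \<open>The intersection of the closed invariant neighborhoods\<close>

context IN_group
begin

lemma IN_kernel_subset_carrier: "IN_kernel G T \<subseteq> carrier G"
proof -
  have "invariant G (carrier G)"
    by (rule invariantI) auto
  moreover have "closedin T (carrier G)"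
    by (simp flip: topspace_eq_carrier)
  moreover have "neighborhood_of T \<one> (carrier G)"
    unfolding neighborhood_of_def using openin_topspace [of T] by (auto simp: topspace_eq_carrier)
  ultimately show ?thesis
    by (auto simp: IN_kernel_def)
qed

text \<open>The packing argument.  A set is called good here if it is a left translate of a conjugate of \<open>B\<close>, by an
  element of \<open>D\<close>, and misses \<open>W\<close>; here \<open>B\<close> is a compact neighborhood of \<open>w\<close> and \<open>D\<close> a compact invariant
  neighborhood of \<open>\<one>\<close>.  All good sets lie in \<open>D <#> W\<close>, and the same number of left translates of each
  covers \<open>D <#> W\<close>.  If \<open>x \<otimes> w\<close> were outside \<open>W\<close>, every finite disjoint family of good sets could be enlarged.\<close>

lemma IN_kernel_mult_interior:
  assumes x: "x \<in> IN_kernel G T" and W: "compactin T W" "invariant G W"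
    and w: "w \<in> T interior_of W"
  shows "x \<otimes> w \<in> W"
proof (rule ccontr)
  assume xw: "x \<otimes> w \<notin> W"
  have Wc: "W \<subseteq> carrier G"
    using W subset_carrier_compactin by blast
  have wW: "w \<in> W"
    using w interior_of_subset by (rule set_mp [rotated])
  have xc: "x \<in> carrier G" and wc: "w \<in> carrier G"
    using x IN_kernel_subset_carrier wW Wc by blast+
  have "closedin T W"
    using W Hausdorff compactin_imp_closedin by blast
  then have opW: "openin T (carrier G - W)"
    by (simp add: closedin_def topspace_eq_carrier)
  \<comment> \<open>All \<open>p\<close> near \<open>x\<close>, not just \<open>x\<close> itself, move a whole compact neighborhood \<open>B\<close> of \<open>w\<close> off \<open>W\<close>.\<close>
  obtain P Q where PQ: "openin T P" "openin T Q" "x \<in> P" "w \<in> Q"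
    and PQ_sep: "\<And>p q. \<lbrakk>p \<in> P; q \<in> Q\<rbrakk> \<Longrightarrow> p \<otimes> q \<in> carrier G - W"
    by (rule openin_mult_neighborhoods [OF opW, of x w]) (use xw xc wc in simp_all)
  then have PQW: "p \<otimes> q \<notin> W" if "p \<in> P" "q \<in> Q" for p q
    using that by blast
  have "neighbourhood_base_of (compactin T) T"
    using Hausdorff locally_compact locally_compact_space_neighbourhood_base by blast
  moreover have "openin T (Q \<inter> T interior_of W)" "w \<in> Q \<inter> T interior_of W"
    using PQ w by (simp_all add: openin_Int)
  ultimately obtain N B where N: "openin T N" and B: "compactin T B"
    and wN: "w \<in> N" "N \<subseteq> B" "B \<subseteq> Q \<inter> T interior_of W"
    unfolding neighbourhood_base_of by meson
  have BW: "B \<subseteq> W" and BQ: "B \<subseteq> Q" and Bc: "B \<subseteq> carrier G"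
    using wN Wc interior_of_subset [of T W] by blast+
  obtain D where D: "compactin T D" "invariant G D" "\<one> \<in> T interior_of D"
    using compact_invariant_neighborhood neighborhood_of_iff_interior [OF subset_carrier_compactin]
    by blast
  have Dc: "D \<subseteq> carrier G"
    using D subset_carrier_compactin by blast
  define C where "C = D <#> W"
  have C: "compactin T C" "invariant G C" "C \<subseteq> carrier G"
    using D W by (auto simp: C_def compactin_set_mult invariant_set_mult Wc Dc set_mult_closed)
  have "\<one> \<in> D"
    using D interior_of_subset [of T D] by blast
  then have C_ne: "C \<noteq> {}"
    using wW by (auto simp: C_def set_mult_def)
  obtain F where F: "finite F" "F \<subseteq> carrier G" "C \<subseteq> F <#> N"
    using compactin_covered_by_l_cosets [OF C(1) N wN(1)] .
  let ?c = "\<lambda>g v. g \<otimes> v \<otimes> inv g"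
  define good where
    "good S \<longleftrightarrow> (\<exists>u\<in>D. \<exists>g\<in>carrier G. S = u <# (?c g ` B)) \<and> S \<inter> W = {}" for S
  have good_compact: "compactin T S" if "good S" for S
  proof -
    obtain u g where ug: "u \<in> D" "g \<in> carrier G" "S = u <# (?c g ` B)"
      using \<open>good S\<close> by (auto simp: good_def)
    have "compactin T (?c g ` B)"
      using image_compactin [OF B] homeomorphic_imp_continuous_map [OF homeomorphic_map_conjugation] ug
      by blast
    then show ?thesis
      using ug Dc compactin_l_coset by blast
  qed
  have good_subset: "S \<subseteq> C" if "good S" for S
  proof -
    obtain u g where ug: "u \<in> D" "g \<in> carrier G" "S = u <# (?c g ` B)"
      using \<open>good S\<close> by (auto simp: good_def)
    have "?c g ` B \<subseteq> W"
      using ug BW invariantD [OF W(2)] by blast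
    with ug show ?thesis
      by (auto simp: C_def l_coset_def set_mult_def)
  qed
  have good_cover: "\<exists>E. finite E \<and> E \<subseteq> carrier G \<and> card E \<le> card F \<and> C \<subseteq> E <#> S" if "good S" for S
  proof -
    obtain u g where ug: "u \<in> D" "g \<in> carrier G" "S = u <# (?c g ` B)"
      using \<open>good S\<close> by (auto simp: good_def)
    have uc: "u \<in> carrier G"
      using ug Dc by blast
    let ?E = "(\<lambda>f. ?c g f \<otimes> inv u) ` F"
    \<comment> \<open>Conjugating a cover of the invariant set \<open>C\<close> by translates of \<open>B\<close> gives one by equally many
      translates of the conjugate of \<open>B\<close>.\<close>
    have "C \<subseteq> ?E <#> S"
    proof
      fix c assume "c \<in> C"
      then obtain c' where c': "c' \<in> C" "c = ?c g c'"
        using C(2) ug unfolding invariant_def by blast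
      then have "c' \<in> F <#> N"
        using F(3) by blast
      then obtain f b where fb: "f \<in> F" "b \<in> B" "c' = f \<otimes> b"
        using wN(2) by (auto simp: set_mult_def)
      have "f \<in> carrier G" "b \<in> carrier G"
        using fb F Bc by auto
      then have "c = (?c g f \<otimes> inv u) \<otimes> (u \<otimes> ?c g b)"
        using c' fb ug uc by (simp add: m_assoc mult_inv_cancel_left)
      moreover have "u \<otimes> ?c g b \<in> S"
        using ug fb by (auto simp: l_coset_def)
      ultimately show "c \<in> ?E <#> S"
        using fb unfolding set_mult_def by blast
    qed
    moreover have "finite ?E" "?E \<subseteq> carrier G" "card ?E \<le> card F"
      using F ug uc by (auto intro: card_image_le)
    ultimately show ?thesis by blast
  qed
  have "\<exists>\<S>. finite \<S> \<and> card \<S> = n \<and> pairwise disjnt \<S> \<and> (\<forall>S\<in>\<S>. good S)" for n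
  proof (induction n)
    case 0
    show ?case
      by (rule exI [of _ "{}"]) auto
  next
    case (Suc n)
    then obtain \<S> where \<S>: "finite \<S>" "card \<S> = n" "pairwise disjnt \<S>" "\<And>S. S \<in> \<S> \<Longrightarrow> good S"
      by blast
    let ?X = "\<Union>\<S>"
    have X: "compactin T ?X"
      using \<S> good_compact by (blast intro: compactin_Union)
    have XW: "?X \<inter> W = {}"
      using \<S>(4) by (auto simp: good_def)
    \<comment> \<open>The elements outside \<open>?E\<close> translate \<open>W\<close>, and with it every conjugate of \<open>B\<close>, off the family
      found so far.\<close>
    let ?E = "?X <#> set_inv W"
    have "closedin T ?E"
      using X W Hausdorff by (intro compactin_imp_closedin compactin_set_mult compactin_set_inv)
    then have "openin T (T interior_of D - ?E)"
      by (simp add: openin_diff)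
    moreover have "\<one> \<notin> ?E"
    proof
      assume "\<one> \<in> ?E"
      then obtain s v where sv: "s \<in> ?X" "v \<in> W" "\<one> = s \<otimes> inv v"
        unfolding set_mult_def SET_INV_def by blast
      then have "s \<in> carrier G" "v \<in> carrier G"
        using X Wc subset_carrier_compactin by blast+
      then have "s = v"
        using sv(3) by (metis inv_equality inv_closed inv_inv)
      then show False
        using sv XW by blast
    qed
    ultimately obtain u g where u: "u \<in> T interior_of D - ?E" and g: "g \<in> carrier G" and P: "?c g u \<in> P"
      using orbit_meets_IN_kernel_neighborhood [OF x _ _ PQ(1,3)] D(3) by (metis DiffI)
    have uD: "u \<in> D" and uE: "u \<notin> ?E"
      using u interior_of_subset [of T D] by blast+
    have uc: "u \<in> carrier G"
      using uD Dc by blast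
    let ?S = "u <# (?c (inv g) ` B)"
    have S_el: "\<exists>b\<in>B. s = u \<otimes> ?c (inv g) b" if "s \<in> ?S" for s
      using that by (auto simp: l_coset_def)
    have "?S \<inter> W = {}"
    proof (rule ccontr)
      assume "?S \<inter> W \<noteq> {}"
      then obtain b where b: "b \<in> B" "u \<otimes> ?c (inv g) b \<in> W"
        using S_el by blast
      \<comment> \<open>Conjugation by \<open>g\<close> turns \<open>u\<close> into an element near \<open>x\<close>, which moves \<open>B\<close> off \<open>W\<close>.\<close>
      have "?c g (u \<otimes> ?c (inv g) b) = ?c g u \<otimes> b"
        using b Bc g uc by (simp add: m_assoc subset_eq mult_inv_cancel_left)
      then have "?c g u \<otimes> b \<in> W"
        using invariantD [OF W(2) g b(2)] by simp
      then show False
        using PQW P b BQ by blast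
    qed
    then have S: "good ?S"
      unfolding good_def using uD g by blast
    have SX: "?S \<inter> ?X = {}"
    proof (rule ccontr)
      assume "?S \<inter> ?X \<noteq> {}"
      then obtain b where b: "b \<in> B" "u \<otimes> ?c (inv g) b \<in> ?X"
        using S_el by blast
      let ?v = "?c (inv g) b"
      have v: "?v \<in> W"
        using invariantD [OF W(2)] g b BW by blast
      then have "u = (u \<otimes> ?v) \<otimes> inv ?v"
        using uc Wc by (simp add: m_assoc subset_eq)
      then have "u \<in> ?E"
        using b v unfolding set_mult_def SET_INV_def by blast
      then show False
        using uE by blast
    qed
    have "?S \<noteq> {}"
      using wN by (auto simp: l_coset_def)
    with SX have "?S \<notin> \<S>"
      by blast
    then have "finite (insert ?S \<S>)" "card (insert ?S \<S>) = Suc n"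
      using \<S> by auto
    moreover have "pairwise disjnt (insert ?S \<S>)"
      using \<S>(3) SX unfolding pairwise_insert disjnt_def by blast
    ultimately show ?case
      using \<S>(4) S by (metis insert_iff)
  qed
  then obtain \<S> where \<S>: "finite \<S>" "card \<S> = Suc (card F)" "pairwise disjnt \<S>" "\<And>S. S \<in> \<S> \<Longrightarrow> good S"
    by meson
  have "card \<S> \<le> card F"
    using card_disjoint_compact_le_card_cover [OF \<S>(1,3) good_compact C(1) C_ne good_subset good_cover] \<S>(4)
    by blast
  with \<S>(2) show False
    by simp
qed

lemma IN_kernelI:
  assumes "\<And>V. \<lbrakk>closedin T V; invariant G V; \<one> \<in> T interior_of V\<rbrakk> \<Longrightarrow> x \<in> V"
  shows "x \<in> IN_kernel G T"
  unfolding IN_kernel_def using assms neighborhood_of_iff_interior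
  by (auto simp: invariant_def)

lemma IN_kernelD:
  assumes "x \<in> IN_kernel G T" "closedin T V" "invariant G V" "\<one> \<in> T interior_of V"
  shows "x \<in> V"
proof -
  have "neighborhood_of T \<one> V"
    using assms neighborhood_of_iff_interior by (auto simp: invariant_def)
  with assms show ?thesis
    by (auto simp: IN_kernel_def)
qed

text \<open>Translation by \<open>x\<close> is only controlled on the interior of \<open>W\<close>, and \<open>y \<in> K\<close> need not be an interior point.
  But the closure of the interior is again a closed invariant neighborhood of \<open>\<one>\<close>, so \<open>y\<close> lies in it,
  and \<open>x\<close> still maps this closure into the closed set \<open>W\<close>.\<close>

lemma IN_kernel_mult_closed:
  assumes x: "x \<in> IN_kernel G T" and y: "y \<in> IN_kernel G T"
  shows "x \<otimes> y \<in> IN_kernel G T"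
proof (rule IN_kernelI)
  fix V assume V: "closedin T V" "invariant G V" "\<one> \<in> T interior_of V"
  obtain D where D: "compactin T D" "invariant G D" "\<one> \<in> T interior_of D"
    using compact_invariant_neighborhood neighborhood_of_iff_interior [OF subset_carrier_compactin]
    by blast
  define W where "W = V \<inter> D"
  have W: "compactin T W" "\<one> \<in> T interior_of W"
    using V D by (auto simp: W_def closed_Int_compactin interior_of_Int)
  have invW: "invariant G W"
    using V(2) D(2) unfolding W_def
    by (intro invariantI) (auto simp: invariantD invariant_def)
  have "y \<in> T closure_of (T interior_of W)"
  proof (rule IN_kernelD [OF y])
    show "invariant G (T closure_of (T interior_of W))"
      by (intro invariant_closure_of invariant_interior_of invW)
    have "T interior_of W \<subseteq> T closure_of (T interior_of W)"
      by (simp add: closure_of_subset interior_of_subset_topspace)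
    then show "\<one> \<in> T interior_of (T closure_of (T interior_of W))"
      using W(2) interior_of_maximal openin_interior_of by blast
  qed simp
  moreover have "T closure_of (T interior_of W) \<subseteq> {z \<in> topspace T. x \<otimes> z \<in> W}"
  proof (rule closure_of_minimal)
    show "T interior_of W \<subseteq> {z \<in> topspace T. x \<otimes> z \<in> W}"
      using IN_kernel_mult_interior [OF x W(1) invW] interior_of_subset_topspace by fastforce
    show "closedin T {z \<in> topspace T. x \<otimes> z \<in> W}"
    proof (rule closedin_continuous_map_preimage)
      show "continuous_map T T (\<lambda>z. x \<otimes> z)"
        using x IN_kernel_subset_carrier by (intro continuous_map_group_intros) auto
      show "closedin T W"
        using W Hausdorff compactin_imp_closedin by blast
    qed
  qed
  ultimately show "x \<otimes> y \<in> V"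
    by (auto simp: W_def)
qed

lemma IN_kernel_inv_closed:
  assumes x: "x \<in> IN_kernel G T"
  shows "inv x \<in> IN_kernel G T"
proof (rule IN_kernelI)
  fix V assume V: "closedin T V" "invariant G V" "\<one> \<in> T interior_of V"
  let ?V = "{z \<in> topspace T. inv z \<in> V}"
  let ?U = "{z \<in> topspace T. inv z \<in> T interior_of V}"
  have "x \<in> ?V"
  proof (rule IN_kernelD [OF x])
    show "closedin T ?V"
      by (rule closedin_continuous_map_preimage [OF continuous_inv V(1)])
    show "invariant G ?V"
    proof (rule invariantI)
      fix g v assume g: "g \<in> carrier G" and v: "v \<in> ?V"
      then have "inv (g \<otimes> v \<otimes> inv g) = g \<otimes> inv v \<otimes> inv g"
        by (simp add: topspace_eq_carrier inv_mult_group m_assoc)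
      then show "g \<otimes> v \<otimes> inv g \<in> ?V"
        using g v invariantD [OF V(2)] by (simp add: topspace_eq_carrier)
    qed (auto simp: topspace_eq_carrier)
    have "openin T ?U"
      by (rule openin_continuous_map_preimage [OF continuous_inv]) simp
    moreover have "?U \<subseteq> ?V"
      using interior_of_subset [of T V] by blast
    moreover have "\<one> \<in> ?U"
      using V(3) by (simp add: topspace_eq_carrier)
    ultimately show "\<one> \<in> T interior_of ?V"
      using interior_of_maximal by blast
  qed
  then show "inv x \<in> V"
    by simp
qed

theorem IN_kernel_normal: "IN_kernel G T \<lhd> G"
proof (rule normal_invI)
  have "\<one> \<in> IN_kernel G T"
    by (rule IN_kernelI) (rule set_mp [OF interior_of_subset])
  then show "subgroup (IN_kernel G T) G"
    using IN_kernel_subset_carrier IN_kernel_mult_closed IN_kernel_inv_closed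
    by (intro subgroupI) auto
  show "g \<otimes> x \<otimes> inv g \<in> IN_kernel G T" if "g \<in> carrier G" "x \<in> IN_kernel G T" for g x
    using that by (auto intro!: IN_kernelI invariantD dest: IN_kernelD)
qed

end

section \<open>Uniformly continuous functions and quotients\<close>

context topological_group
begin

text \<open>The set \<open>V\<close> of elements whose insertion changes values of \<open>f\<close> by at most \<open>\<epsilon>\<close> is a closed invariant
  neighborhood of \<open>\<one>\<close>; here \<open>\<epsilon>\<close> is half of an alleged change caused by \<open>k\<close>.\<close>

lemma UCS_translate_by_IN_kernel:
  assumes f: "f \<in> UCS G T" and k: "k \<in> IN_kernel G T"
    and x: "x \<in> carrier G" and y: "y \<in> carrier G"
  shows "f (x \<otimes> k \<otimes> y) = f (x \<otimes> y)"
proof (rule ccontr)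
  assume ne: "f (x \<otimes> k \<otimes> y) \<noteq> f (x \<otimes> y)"
  define \<epsilon> where "\<epsilon> = dist (f (x \<otimes> k \<otimes> y)) (f (x \<otimes> y)) / 2"
  have \<epsilon>: "\<epsilon> > 0"
    using ne by (simp add: \<epsilon>_def)
  define V where
    "V = (\<Inter>x\<in>carrier G. \<Inter>y\<in>carrier G. {v \<in> topspace T. f (x \<otimes> v \<otimes> y) \<in> cball (f (x \<otimes> y)) \<epsilon>})"
  have V_iff: "v \<in> V \<longleftrightarrow> v \<in> carrier G \<and>
      (\<forall>x\<in>carrier G. \<forall>y\<in>carrier G. dist (f (x \<otimes> v \<otimes> y)) (f (x \<otimes> y)) \<le> \<epsilon>)" for v
    unfolding V_def by (auto simp: topspace_eq_carrier dist_commute)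
  have contf: "continuous_map T euclidean f"
    using f by (simp add: UCS_def bounded_continuous_def)
  have "closedin T V"
    unfolding V_def
  proof (intro closedin_INT)
    fix x y assume "x \<in> carrier G" "y \<in> carrier G"
    then have "continuous_map T T (\<lambda>v. x \<otimes> v \<otimes> y)"
      by (intro continuous_map_group_intros)
    from continuous_map_compose [OF this contf]
    have "continuous_map T euclidean (\<lambda>v. f (x \<otimes> v \<otimes> y))"
      by (simp add: o_def)
    then show "closedin T {v \<in> topspace T. f (x \<otimes> v \<otimes> y) \<in> cball (f (x \<otimes> y)) \<epsilon>}"
      by (rule closedin_continuous_map_preimage) simp
  qed auto
  moreover have "invariant G V"
  proof (rule invariantI)
    fix g v assume g: "g \<in> carrier G" and v: "v \<in> V"
    have vc: "v \<in> carrier G"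
      using v V_iff by blast
    have "dist (f (a \<otimes> (g \<otimes> v \<otimes> inv g) \<otimes> b)) (f (a \<otimes> b)) \<le> \<epsilon>"
      if ab: "a \<in> carrier G" "b \<in> carrier G" for a b
    proof -
      have "dist (f ((a \<otimes> g) \<otimes> v \<otimes> (inv g \<otimes> b))) (f ((a \<otimes> g) \<otimes> (inv g \<otimes> b))) \<le> \<epsilon>"
        using v g ab V_iff by simp
      then show ?thesis
        using g ab vc by (simp add: m_assoc mult_inv_cancel_left)
    qed
    then show "g \<otimes> v \<otimes> inv g \<in> V"
      using V_iff g vc by simp
  qed (use V_iff in auto)
  moreover have "neighborhood_of T \<one> V"
  proof -
    have "equicontinuous T (double_orbit G f)"
      using f by (simp add: UCS_def)
    then obtain U where U: "openin T U" "\<one> \<in> U"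
      and Ue: "\<And>p w. \<lbrakk>p \<in> double_orbit G f; w \<in> U\<rbrakk> \<Longrightarrow> dist (p w) (p \<one>) < \<epsilon>"
      using \<epsilon> unfolding equicontinuous_def topspace_eq_carrier by (meson one_closed)
    have "U \<subseteq> V"
    proof
      fix w assume w: "w \<in> U"
      then have wc: "w \<in> carrier G"
        using U subset_carrier_openin by blast
      have "dist (f (a \<otimes> w \<otimes> b)) (f (a \<otimes> b)) \<le> \<epsilon>" if "a \<in> carrier G" "b \<in> carrier G" for a b
      proof -
        have "(\<lambda>z\<in>carrier G. f (a \<otimes> z \<otimes> b)) \<in> double_orbit G f"
          using that unfolding double_orbit_def by blast
        from Ue [OF this w] show ?thesis
          using that wc by simp
      qed
      then show "w \<in> V"
        using V_iff wc by blast
    qed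
    then show ?thesis
      unfolding neighborhood_of_def topspace_eq_carrier using U V_iff by blast
  qed
  ultimately have "k \<in> V"
    using k by (simp add: IN_kernel_def)
  then have "2 * \<epsilon> \<le> \<epsilon>"
    using x y V_iff by (simp add: \<epsilon>_def)
  with \<epsilon> show False
    by simp
qed

context
  fixes N
  assumes N: "N \<lhd> G"
begin

lemma quotient_hom_in_carrier: "x \<in> carrier G \<Longrightarrow> quotient_hom G N x \<in> carrier (G Mod N)"
  by (auto simp: carrier_FactGroup quotient_hom_def)

lemma quotient_hom_mult:
  "\<lbrakk>x \<in> carrier G; y \<in> carrier G\<rbrakk> \<Longrightarrow>
    quotient_hom G N (x \<otimes> y) = quotient_hom G N x \<otimes>\<^bsub>G Mod N\<^esub> quotient_hom G N y"
  by (simp add: quotient_hom_def normal.rcos_sum [OF N])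

text \<open>The saturation of \<open>U\<close> is the union of its translates by elements of \<open>N\<close>.\<close>

lemma openin_quotient_hom_image:
  assumes U: "openin T U"
  shows "openin (quotient_topology G T N) (quotient_hom G N ` U)"
  unfolding openin_quotient_topology [OF topspace_eq_carrier]
proof
  have Uc: "U \<subseteq> carrier G"
    using U subset_carrier_openin by blast
  have sN: "subgroup N G" and Nc: "N \<subseteq> carrier G"
    using N normal_imp_subgroup subgroup.subset by blast+
  show "quotient_hom G N ` U \<subseteq> carrier (G Mod N)"
    using Uc quotient_hom_in_carrier by blast
  have "{x \<in> carrier G. quotient_hom G N x \<in> quotient_hom G N ` U} = (\<Union>k\<in>N. k <# U)"
  proof (intro equalityI subsetI)
    fix x assume "x \<in> {x \<in> carrier G. quotient_hom G N x \<in> quotient_hom G N ` U}"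
    then obtain u where u: "x \<in> carrier G" "u \<in> U" "N #> x = N #> u"
      by (auto simp: quotient_hom_def)
    then have "x \<in> N #> u"
      using repr_independenceD sN Uc rcos_self by blast
    then show "x \<in> (\<Union>k\<in>N. k <# U)"
      using u by (auto simp: r_coset_def l_coset_def)
  next
    fix x assume "x \<in> (\<Union>k\<in>N. k <# U)"
    then obtain k u where ku: "k \<in> N" "u \<in> U" "x = k \<otimes> u"
      by (auto simp: l_coset_def)
    then have "x \<in> N #> u"
      by (auto simp: r_coset_def)
    then have "N #> u = N #> x"
      using repr_independence sN Uc ku by blast
    moreover have "x \<in> carrier G"
      using ku Nc Uc by auto
    ultimately show "x \<in> {x \<in> carrier G. quotient_hom G N x \<in> quotient_hom G N ` U}"
      using ku by (auto simp: quotient_hom_def)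
  qed
  moreover have "openin T (\<Union>k\<in>N. k <# U)"
    using U Nc openin_l_coset by blast
  ultimately show "openin T {x \<in> carrier G. quotient_hom G N x \<in> quotient_hom G N ` U}"
    by simp
qed

lemma UCS_compose_quotient_hom:
  assumes h: "h \<in> UCS (G Mod N) (quotient_topology G T N)"
  shows "compose (carrier G) h (quotient_hom G N) \<in> UCS G T"
proof -
  let ?q = "quotient_hom G N" and ?Q = "quotient_topology G T N"
  let ?f = "compose (carrier G) h ?q"
  have qm: "quotient_map T ?Q ?q"
    by (rule quotient_map_quotient_hom [OF topspace_eq_carrier])
  have hc: "continuous_map ?Q euclidean h" and hb: "bounded (h ` carrier (G Mod N))"
    and he: "equicontinuous ?Q (double_orbit (G Mod N) h)"
    using h by (auto simp: UCS_def bounded_continuous_def)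
  have f: "?f x = h (?q x)" if "x \<in> carrier G" for x
    using that by (simp add: compose_def)
  have "continuous_map T euclidean (h \<circ> ?q)"
    using continuous_map_compose quotient_imp_continuous_map [OF qm] hc by blast
  then have "continuous_map T euclidean ?f"
    by (rule continuous_map_eq) (simp add: f topspace_eq_carrier)
  moreover have "bounded (?f ` carrier G)"
    by (rule bounded_subset [OF hb]) (auto simp: f quotient_hom_in_carrier)
  moreover have "equicontinuous T (double_orbit G ?f)"
    unfolding equicontinuous_def
  proof (intro ballI allI impI)
    fix z and \<epsilon> :: real
    assume z: "z \<in> topspace T" and \<epsilon>: "\<epsilon> > 0"
    then have zc: "z \<in> carrier G"
      by (simp add: topspace_eq_carrier)
    then have "?q z \<in> topspace ?Q"
      using quotient_hom_in_carrier by (simp add: topspace_quotient_topology [OF topspace_eq_carrier])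
    then obtain U where U: "openin ?Q U" "?q z \<in> U"
      and Ue: "\<And>p w. \<lbrakk>p \<in> double_orbit (G Mod N) h; w \<in> U\<rbrakk> \<Longrightarrow> dist (p w) (p (?q z)) < \<epsilon>"
      using he \<epsilon> unfolding equicontinuous_def by meson
    let ?U = "{x \<in> carrier G. ?q x \<in> U}"
    have "openin T ?U"
      using U openin_quotient_topology [OF topspace_eq_carrier] by blast
    moreover have "z \<in> ?U"
      using U zc by simp
    moreover have "dist (p w) (p z) < \<epsilon>" if p: "p \<in> double_orbit G ?f" and w: "w \<in> ?U" for p w
    proof -
      obtain x y where xy: "x \<in> carrier G" "y \<in> carrier G" "p = (\<lambda>z\<in>carrier G. ?f (x \<otimes> z \<otimes> y))"
        using p by (auto simp: double_orbit_def)
      let ?p = "\<lambda>z\<in>carrier (G Mod N). h (?q x \<otimes>\<^bsub>G Mod N\<^esub> z \<otimes>\<^bsub>G Mod N\<^esub> ?q y)"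
      have "?p \<in> double_orbit (G Mod N) h"
        using xy quotient_hom_in_carrier unfolding double_orbit_def by blast
      then have "dist (?p (?q w)) (?p (?q z)) < \<epsilon>"
        using Ue w by blast
      moreover have "p v = ?p (?q v)" if "v \<in> carrier G" for v
        using that xy by (simp add: f quotient_hom_in_carrier quotient_hom_mult)
      ultimately show ?thesis
        using w zc by simp
    qed
    ultimately show "\<exists>U. openin T U \<and> z \<in> U \<and>
        (\<forall>g\<in>double_orbit G ?f. \<forall>w\<in>U. dist (g w) (g z) < \<epsilon>)"
      by blast
  qed
  ultimately show ?thesis
    by (simp add: UCS_def bounded_continuous_def compose_extensional)
qed

text \<open>Continuity of the factor is the universal property of the quotient topology.  Its equicontinuity at
  a coset uses the image of a neighborhood that works for \<open>f\<close>, which is why the quotient map has to be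
  open.\<close>

lemma UCS_factors_through_quotient_hom:
  assumes f: "f \<in> UCS G T"
    and inv: "\<And>k x. \<lbrakk>k \<in> N; x \<in> carrier G\<rbrakk> \<Longrightarrow> f (k \<otimes> x) = f x"
  obtains h where "h \<in> UCS (G Mod N) (quotient_topology G T N)"
    "f = compose (carrier G) h (quotient_hom G N)"
proof -
  let ?q = "quotient_hom G N" and ?Q = "quotient_topology G T N"
  have qm: "quotient_map T ?Q ?q"
    by (rule quotient_map_quotient_hom [OF topspace_eq_carrier])
  have q_surj: "carrier (G Mod N) = ?q ` carrier G"
    by (auto simp: carrier_FactGroup quotient_hom_def)
  have fe: "f \<in> extensional (carrier G)" and fc: "continuous_map T euclidean f"
    and fb: "bounded (f ` carrier G)" and fq: "equicontinuous T (double_orbit G f)"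
    using f by (auto simp: UCS_def bounded_continuous_def)
  define h where "h = (\<lambda>X\<in>carrier (G Mod N). f (SOME x. x \<in> X))"
  have h: "h (?q x) = f x" if x: "x \<in> carrier G" for x
  proof -
    have "x \<in> ?q x"
      unfolding quotient_hom_def using x N normal_imp_subgroup rcos_self by blast
    then have "(SOME y. y \<in> ?q x) \<in> ?q x"
      by (rule someI)
    then obtain k where "k \<in> N" "(SOME y. y \<in> ?q x) = k \<otimes> x"
      by (auto simp: quotient_hom_def r_coset_def)
    then show ?thesis
      using x by (simp add: h_def quotient_hom_in_carrier inv)
  qed
  have "continuous_map T euclidean (h \<circ> ?q)"
    by (rule continuous_map_eq [OF fc]) (simp add: h topspace_eq_carrier)
  then have "continuous_map ?Q euclidean h"
    using continuous_compose_quotient_map [OF qm] by blast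
  moreover have "h ` carrier (G Mod N) = f ` carrier G"
    unfolding q_surj by (auto simp: h image_image)
  moreover have "equicontinuous ?Q (double_orbit (G Mod N) h)"
    unfolding equicontinuous_def topspace_quotient_topology [OF topspace_eq_carrier] q_surj
  proof (intro ballI allI impI)
    fix Z and \<epsilon> :: real
    assume "Z \<in> ?q ` carrier G" and \<epsilon>: "\<epsilon> > 0"
    then obtain z where z: "z \<in> carrier G" "Z = ?q z"
      by blast
    then obtain U where U: "openin T U" "z \<in> U"
      and Ue: "\<And>p w. \<lbrakk>p \<in> double_orbit G f; w \<in> U\<rbrakk> \<Longrightarrow> dist (p w) (p z) < \<epsilon>"
      using fq \<epsilon> unfolding equicontinuous_def topspace_eq_carrier by meson
    have Uc: "U \<subseteq> carrier G"
      using U subset_carrier_openin by blast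
    have "dist (p W) (p Z) < \<epsilon>" if p: "p \<in> double_orbit (G Mod N) h" and W: "W \<in> ?q ` U" for p W
    proof -
      obtain X Y where XY: "X \<in> carrier (G Mod N)" "Y \<in> carrier (G Mod N)"
        "p = (\<lambda>z\<in>carrier (G Mod N). h (X \<otimes>\<^bsub>G Mod N\<^esub> z \<otimes>\<^bsub>G Mod N\<^esub> Y))"
        using p unfolding double_orbit_def by blast
      obtain x y where xy: "x \<in> carrier G" "X = ?q x" "y \<in> carrier G" "Y = ?q y"
        using XY unfolding q_surj by blast
      obtain w where w: "w \<in> U" "W = ?q w"
        using W by blast
      let ?p = "\<lambda>z\<in>carrier G. f (x \<otimes> z \<otimes> y)"
      have "?p \<in> double_orbit G f"
        using xy unfolding double_orbit_def by blast
      then have "dist (?p w) (?p z) < \<epsilon>"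
        using Ue w by blast
      moreover have "p (?q v) = ?p v" if "v \<in> carrier G" for v
      proof -
        have "X \<otimes>\<^bsub>G Mod N\<^esub> ?q v \<otimes>\<^bsub>G Mod N\<^esub> Y = ?q (x \<otimes> v \<otimes> y)"
          using that xy by (simp add: quotient_hom_mult)
        then have "p (?q v) = h (?q (x \<otimes> v \<otimes> y))"
          unfolding XY(3) using that by (simp add: quotient_hom_in_carrier)
        then show ?thesis
          using that xy by (simp add: h)
      qed
      ultimately show ?thesis
        using w z Uc by auto
    qed
    then show "\<exists>U. openin ?Q U \<and> Z \<in> U \<and>
        (\<forall>g\<in>double_orbit (G Mod N) h. \<forall>w\<in>U. dist (g w) (g Z) < \<epsilon>)"
      using openin_quotient_hom_image [OF U(1)] U(2) z by blast
  qed
  ultimately have "h \<in> UCS (G Mod N) ?Q"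
    using fb by (simp add: UCS_def bounded_continuous_def h_def)
  moreover have "f = compose (carrier G) h ?q"
    using fe by (intro extensionalityI [of _ "carrier G"]) (auto simp: compose_def h)
  ultimately show ?thesis
    using that by blast
qed

end

end

section \<open>The factorization theorem\<close>

theorem lemma2p3:
  fixes G :: "('a, 'b) monoid_scheme" and T :: "'a topology"
  assumes "IN_group G T"
  defines "K \<equiv> IN_kernel G T"
  shows "UCS G T =
    {compose (carrier G) h (quotient_hom G K) | h. h \<in> UCS (G Mod K) (quotient_topology G T K)}"
proof (intro equalityI subsetI)
  interpret IN_group G T
    by (rule assms(1))
  have K: "K \<lhd> G"
    unfolding K_def by (rule IN_kernel_normal)
  {
    fix f assume f: "f \<in> UCS G T"
    have "f (k \<otimes>\<^bsub>G\<^esub> x) = f x" if "k \<in> K" "x \<in> carrier G" for k x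
      using UCS_translate_by_IN_kernel [OF f, of k "\<one>\<^bsub>G\<^esub>" x] that IN_kernel_subset_carrier
      by (auto simp: K_def)
    then obtain h where "h \<in> UCS (G Mod K) (quotient_topology G T K)"
      "f = compose (carrier G) h (quotient_hom G K)"
      using UCS_factors_through_quotient_hom [OF K f] by metis
    then show "f \<in> {compose (carrier G) h (quotient_hom G K) | h.
        h \<in> UCS (G Mod K) (quotient_topology G T K)}"
      by blast
  next
    fix f assume "f \<in> {compose (carrier G) h (quotient_hom G K) | h.
        h \<in> UCS (G Mod K) (quotient_topology G T K)}"
    then show "f \<in> UCS G T"
      using UCS_compose_quotient_hom [OF K] by blast
  }
qed

end
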